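(* Let $\mathbf p=\{p_k;k\ge1\}$ be a probability distribution on a countable alphabet, and for integers $v\ge 0$ let $\zeta_{1,v}=\sum_{k\ge1}p_k(1-p_k)^v$. The following diversity indices are linear diversity indices, with the following representations: 1. Simpson's index: $\lambda=\sum_{k\ge1}p_k^2=\zeta_{1,0}-\zeta_{1,1}$. 2. Gini–Simpson index: $1-\lambda=\sum_{k\ge1}p_k(1-p_k)=\zeta_{1,1}$. 3. Shannon's entropy: $\displaystyle H=-\sum_{k\ge1}p_k\ln(p_k)=\sum_{v=1}^\infty\frac1v\,\zeta_{1,v}$. 4. Rényi's equivalent entropy, for any $r>0$, $r\ne1$: $\displaystyle h_r=\sum_{k\ge1}p_k^r=\zeta_{1,0}+\sum_{v=1}^\infty\left[\prod_{i=1}^v\left(\frac{i-r}{i}\right)\right]\zeta_{1,v}$. 5. Emlen's index: $\displaystyle D=\sum_{k\ge1}p_ke^{-p_k}=\sum_{v=0}^\infty\frac{e^{-1}}{v!}\,\zeta_{1,v}$. 6. Richness index: $\displaystyle K=\sum_{k\ge1}1[p_k>0]=\sum_{v=0}^\infty\zeta_{1,v}$. 7. Generalized Simpson's index, for integers $u\ge1$, $m\ge0$: $\displaystyle\zeta_{u,m}=\sum_{k\ge1}p_k^u(1-p_k)^m=\sum_{v=0}^{u-1}(-1)^v\binom{u-1}{v}\zeta_{1,m+v}$. Tsallis' entropy $T_r=(1-r)^{-1}\left(\sum_{k\ge1}p_k^r-1\right)$, $r>0$, $r\ne1$, is also a linear diversity index.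
   Context: Here $\zeta_{1,0}=\sum_{k\ge1}p_k(1-p_k)^0\equiv1$, and $1[\cdot]$ is the indicator function. A diversity index is a function $\theta=\theta(\mathbf p)$ with values in $[-\infty,\infty]$. It is called a linear diversity index if $\theta(\mathbf p)=\sum_{v=0}^\infty w_v\zeta_{1,v}=\sum_{v=0}^\infty w_v\sum_{k\ge1}p_k(1-p_k)^v$ for some choice of weights $w_v$ such that, for every $\mathbf p$, the sum either converges or diverges to $\pm\infty$. *)

theory Defs
  imports "HOL-Probability.Probability_Mass_Function" "HOL-Analysis.Infinite_Sum"
begin

text \<open>
  A probability distribution on a countable alphabet is a pmf on a countable type; diversity
  indices take values in the extended reals.  All the alphabet sums below have terms of constant
  sign, so they always exist in the extended reals as unordered sums.
\<close>

type_synonym 'a diversity_index = "'a pmf \<Rightarrow> ereal"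

definition zeta :: "nat \<Rightarrow> nat \<Rightarrow> 'a::countable diversity_index" where
  "zeta u m p = (\<Sum>\<^sub>\<infinity>k. ereal (pmf p k ^ u * (1 - pmf p k) ^ m))"

text \<open>
  On the extended reals, \<open>sums\<close> means that the partial sums converge to a real number or
  diverge to plus or minus infinity, the limit being the stated value.
\<close>

definition linear_diversity_index :: "'a::countable diversity_index \<Rightarrow> bool" where
  "linear_diversity_index \<theta> \<longleftrightarrow>
     (\<exists>w :: nat \<Rightarrow> real. \<forall>p. (\<lambda>v. ereal (w v) * zeta 1 v p) sums \<theta> p)"

definition simpson :: "'a::countable diversity_index" where
  "simpson p = (\<Sum>\<^sub>\<infinity>k. ereal ((pmf p k)\<^sup>2))"

definition gini_simpson :: "'a::countable diversity_index" where
  "gini_simpson p = 1 - simpson p"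

text \<open>The usual convention \<open>0 ln 0 = 0\<close> holds because \<open>ln 0 = 0\<close> in the library.\<close>

definition shannon_entropy :: "'a::countable diversity_index" where
  "shannon_entropy p = - (\<Sum>\<^sub>\<infinity>k. ereal (pmf p k * ln (pmf p k)))"

definition renyi_equivalent_entropy :: "real \<Rightarrow> 'a::countable diversity_index" where
  "renyi_equivalent_entropy r p = (\<Sum>\<^sub>\<infinity>k. ereal (pmf p k powr r))"

definition tsallis_entropy :: "real \<Rightarrow> 'a::countable diversity_index" where
  "tsallis_entropy r p =
     ereal (inverse (1 - r)) * ((\<Sum>\<^sub>\<infinity>k. ereal (pmf p k powr r)) - 1)"

definition emlen_index :: "'a::countable diversity_index" where
  "emlen_index p = (\<Sum>\<^sub>\<infinity>k. ereal (pmf p k * exp (- pmf p k)))"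

definition richness :: "'a::countable diversity_index" where
  "richness p = (\<Sum>\<^sub>\<infinity>k. ereal (of_bool (pmf p k > 0)))"

end

theory Submission
  imports Defs "HOL-Analysis.Extended_Real_Limits" "HOL-Analysis.Gamma_Function" "HOL-Analysis.Generalised_Binomial_Theorem"
begin

text \<open>
  Each index has the form $\sum_k p_k\, g(p_k) = E[g(p_X)]$ with $X$ distributed according to $p$,
  where $g(x) = \sum_v w_v (1-x)^v$ for $0 < x \le 1$, while $\zeta_{1,v} = E[(1-p_X)^v]$. The
  representation therefore amounts to exchanging expectation and sum: by monotone convergence if
  $w \ge 0$, and by absolute convergence if $\sum_v |w_v| < \infty$. The latter is needed only for
  finitely many weights and for $h_r$ with $r > 1$, where
  $w_v = (-1)^v \binom{r-1}{v} = O(v^{-r})$.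
\<close>

section \<open>Unordered sums of extended reals as integrals over counting measure\<close>

lemma infsum_ennreal_eq_nn_integral:
  fixes f :: "'a::countable \<Rightarrow> ennreal"
  shows "infsum f UNIV = (\<integral>\<^sup>+k. f k \<partial>count_space UNIV)"
proof (rule antisym)
  have inf: "infsum f UNIV = (SUP F\<in>{F. finite F \<and> F \<subseteq> UNIV}. sum f F)"
    by (rule nonneg_infsum_complete) simp
  have eq: "(\<integral>\<^sup>+k. f k * indicator F k \<partial>count_space UNIV) = sum f F" if "finite F" for F
    using that
    by (simp flip: nn_integral_count_space_indicator add: nn_integral_count_space_finite)
  show "infsum f UNIV \<le> (\<integral>\<^sup>+k. f k \<partial>count_space UNIV)"
    unfolding inf
  proof (rule SUP_least)
    fix F :: "'a set" assume "F \<in> {F. finite F \<and> F \<subseteq> UNIV}"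
    then have "sum f F = (\<integral>\<^sup>+k. f k * indicator F k \<partial>count_space UNIV)"
      by (simp add: eq)
    also have "\<dots> \<le> (\<integral>\<^sup>+k. f k \<partial>count_space UNIV)"
      by (intro nn_integral_mono) (auto split: split_indicator)
    finally show "sum f F \<le> \<dots>" .
  qed
  \<comment> \<open>An increasing exhaustion of the countable alphabet by sets that are finite
    because \<open>to_nat\<close> is injective. Monotone convergence along it bounds the integral by
    a supremum of finite partial sums.\<close>
  define A :: "nat \<Rightarrow> 'a set" where "A n = {k. to_nat k < n}" for n
  have fin: "finite (A n)" for n
    unfolding A_def using finite_vimageI[of "{..<n}" "to_nat :: 'a \<Rightarrow> nat"] by (simp add: vimage_def)
  have "(SUP n. f k * indicator (A n) k) = f k" for k
  proof (rule antisym)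
    show "(SUP n. f k * indicator (A n) k) \<le> f k"
      by (intro SUP_least) (auto split: split_indicator)
    show "f k \<le> (SUP n. f k * indicator (A n) k)"
      by (rule SUP_upper2[of "Suc (to_nat k)"]) (auto simp: A_def)
  qed
  then have "(\<integral>\<^sup>+k. f k \<partial>count_space UNIV) = (\<integral>\<^sup>+k. (SUP n. f k * indicator (A n) k) \<partial>count_space UNIV)"
    by simp
  also have "\<dots> = (SUP n. \<integral>\<^sup>+k. f k * indicator (A n) k \<partial>count_space UNIV)"
    by (rule nn_integral_monotone_convergence_SUP)
       (auto simp: incseq_def le_fun_def A_def split: split_indicator)
  also have "\<dots> \<le> infsum f UNIV"
    unfolding inf by (intro SUP_least SUP_upper2[of "A _"]) (auto simp: eq fin)
  finally show "(\<integral>\<^sup>+k. f k \<partial>count_space UNIV) \<le> infsum f UNIV" .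
qed

text \<open>\<open>enn2ereal\<close> is additive and continuous, hence commutes with unordered sums.
  This moves alphabet sums to nonnegative integrals, where the convergence theorems apply.\<close>

lemma infsum_ereal_eq_nn_integral:
  fixes f :: "'a::countable \<Rightarrow> real"
  assumes "\<And>k. f k \<ge> 0"
  shows "(\<Sum>\<^sub>\<infinity>k. ereal (f k)) = enn2ereal (\<integral>\<^sup>+k. ennreal (f k) \<partial>count_space UNIV)"
proof -
  have "(\<Sum>\<^sub>\<infinity>k. ereal (f k)) = infsum (enn2ereal \<circ> (\<lambda>k. ennreal (f k))) UNIV"
    by (intro infsum_cong) (simp add: assms)
  also have "\<dots> = enn2ereal (\<Sum>\<^sub>\<infinity>k. ennreal (f k))"
    by (rule infsum_comm_additive_general)
       (auto simp: continuous_at_enn2ereal intro: nonneg_summable_on_complete)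
  finally show ?thesis by (simp add: infsum_ennreal_eq_nn_integral)
qed

text \<open>Negation is additive on finite sums of real terms and continuous at every extended real,
  so it passes through the sum even if that is infinite. Needed for Shannon's entropy, whose sign
  stands outside a sum of nonpositive terms.\<close>

lemma infsum_ereal_uminus_nonneg:
  fixes f :: "'a \<Rightarrow> real"
  assumes "\<And>k. f k \<ge> 0"
  shows "(\<Sum>\<^sub>\<infinity>k. ereal (- f k)) = - (\<Sum>\<^sub>\<infinity>k. ereal (f k))"
proof -
  have "infsum (uminus \<circ> (\<lambda>k. ereal (f k))) UNIV = - (\<Sum>\<^sub>\<infinity>k. ereal (f k))"
  proof (rule infsum_comm_additive_general)
    show "isCont uminus (\<Sum>\<^sub>\<infinity>k. ereal (f k))"
      by (auto simp: isCont_def)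
    show "(\<lambda>k. ereal (f k)) summable_on UNIV"
      by (rule nonneg_summable_on_complete) (simp add: assms)
  qed (simp add: sum_negf)
  then show ?thesis by (simp add: comp_def)
qed

lemma ereal_sums_Suc:
  fixes a :: "nat \<Rightarrow> ereal"
  assumes "a sums s" "\<bar>a 0\<bar> \<noteq> \<infinity>"
  shows "(\<lambda>v. a (Suc v)) sums (s - a 0)"
proof -
  have "(\<lambda>n. \<Sum>v<Suc n. a v) \<longlonglongrightarrow> s"
    using assms(1) unfolding sums_def by (rule LIMSEQ_Suc)
  then have "(\<lambda>n. (\<Sum>v<Suc n. a v) - a 0) \<longlonglongrightarrow> s - a 0"
    using assms(2) by (intro tendsto_diff_ereal_general) auto
  moreover have "(\<Sum>v<Suc n. a v) - a 0 = (\<Sum>v<n. a (Suc v))" for n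
    unfolding sum.lessThan_Suc_shift using assms(2)
    by (cases "a 0"; cases "\<Sum>v<n. a (Suc v)") auto
  ultimately show ?thesis by (simp add: sums_def)
qed

section \<open>Expectations under \<open>p\<close> and their exchange with the series\<close>

context
  fixes p :: "'a::countable pmf"
begin

lemma AE_pmf_pos: "AE k in measure_pmf p. 0 < pmf p k \<and> pmf p k \<le> 1"
  by (auto simp: AE_measure_pmf_iff pmf_positive pmf_le_1)

text \<open>The factor \<open>pmf p k\<close> is the density of \<open>measure_pmf p\<close> with
  respect to counting measure. Letters of probability zero contribute nothing, so \<open>g\<close>
  matters only on (0,1].\<close>

lemma infsum_pmf_mult_eq_nn_integral:
  assumes "\<And>x. 0 < x \<Longrightarrow> x \<le> 1 \<Longrightarrow> g x \<ge> 0"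
  shows "(\<Sum>\<^sub>\<infinity>k. ereal (pmf p k * g (pmf p k))) = enn2ereal (\<integral>\<^sup>+k. ennreal (g (pmf p k)) \<partial>measure_pmf p)"
proof -
  have nn: "pmf p k * g (pmf p k) \<ge> 0" for k
    using assms[of "pmf p k"] pmf_nonneg[of p k] pmf_le_1[of p k]
    by (cases "pmf p k = 0") auto
  have "ennreal (pmf p k * g (pmf p k)) = ennreal (pmf p k) * ennreal (g (pmf p k))" for k
    by (simp add: ennreal_mult')
  then show ?thesis
    by (simp add: infsum_ereal_eq_nn_integral nn nn_integral_measure_pmf)
qed

text \<open>A bounded \<open>g\<close> is integrable, which makes the alphabet sum a real
  number.\<close>

lemma infsum_pmf_mult_eq_expectation:
  assumes "\<And>x. 0 < x \<Longrightarrow> x \<le> 1 \<Longrightarrow> g x \<ge> 0" "\<And>x. 0 < x \<Longrightarrow> x \<le> 1 \<Longrightarrow> g x \<le> B"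
  shows "(\<Sum>\<^sub>\<infinity>k. ereal (pmf p k * g (pmf p k))) = ereal (measure_pmf.expectation p (\<lambda>k. g (pmf p k)))"
proof -
  have AE: "AE k in measure_pmf p. 0 \<le> g (pmf p k) \<and> g (pmf p k) \<le> B"
    using AE_pmf_pos by eventually_elim (use assms in auto)
  have "integrable (measure_pmf p) (\<lambda>k. g (pmf p k))"
    by (rule measure_pmf.integrable_const_bound[of _ B]; use AE in \<open>force elim: eventually_mono\<close>)
  then have "(\<integral>\<^sup>+k. ennreal (g (pmf p k)) \<partial>measure_pmf p) = ennreal (measure_pmf.expectation p (\<lambda>k. g (pmf p k)))"
    by (rule nn_integral_eq_integral; use AE in \<open>force elim: eventually_mono\<close>)
  moreover have "measure_pmf.expectation p (\<lambda>k. g (pmf p k)) \<ge> 0"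
    by (rule integral_nonneg_AE) (use AE in \<open>force elim: eventually_mono\<close>)
  ultimately show ?thesis
    by (simp add: infsum_pmf_mult_eq_nn_integral assms)
qed

lemma zeta_eq_expectation:
  "zeta (Suc 0) v p = ereal (measure_pmf.expectation p (\<lambda>k. (1 - pmf p k) ^ v))"
  using infsum_pmf_mult_eq_expectation[of "\<lambda>x. (1 - x) ^ v" 1]
  by (simp add: zeta_def power_le_one)

lemma zeta_eq_nn_integral:
  "zeta (Suc 0) v p = enn2ereal (\<integral>\<^sup>+k. ennreal ((1 - pmf p k) ^ v) \<partial>measure_pmf p)"
  using infsum_pmf_mult_eq_nn_integral[of "\<lambda>x. (1 - x) ^ v"] by (simp add: zeta_def)

lemma zeta_1_0: "zeta (Suc 0) 0 p = 1"
  by (simp add: zeta_eq_expectation one_ereal_def)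

text \<open>Monotone convergence exchanges integral and series without any finiteness, so the common
  value may be infinite.\<close>

lemma nonneg_weights_sums:
  assumes w: "\<And>v. w v \<ge> 0"
    and g: "\<And>x. 0 < x \<Longrightarrow> x \<le> 1 \<Longrightarrow> (\<lambda>v. w v * (1 - x) ^ v) sums g x"
  shows "(\<lambda>v. ereal (w v) * zeta 1 v p) sums (\<Sum>\<^sub>\<infinity>k. ereal (pmf p k * g (pmf p k)))"
proof -
  have nn: "w v * (1 - x) ^ v \<ge> 0" if "x \<le> 1" for v x
    using that w by simp
  have "ereal (w v) * zeta 1 v p = enn2ereal (\<integral>\<^sup>+k. ennreal (w v * (1 - pmf p k) ^ v) \<partial>measure_pmf p)" for v
    using w[of v]
    by (simp add: zeta_eq_nn_integral ennreal_mult nn_integral_cmult times_ennreal.rep_eq pmf_le_1)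
  moreover have "(\<integral>\<^sup>+k. ennreal (g (pmf p k)) \<partial>measure_pmf p) =
      (\<integral>\<^sup>+k. (\<Sum>v. ennreal (w v * (1 - pmf p k) ^ v)) \<partial>measure_pmf p)"
  \<comment> \<open>The expansion of \<open>g\<close> is known only for positive arguments and may
    fail at 0, but letters of probability zero form a null set.\<close>
  proof (rule nn_integral_cong_AE)
    show "AE k in measure_pmf p. ennreal (g (pmf p k)) = (\<Sum>v. ennreal (w v * (1 - pmf p k) ^ v))"
      using AE_pmf_pos
    proof eventually_elim
      case (elim k)
      then show ?case
        using suminf_ennreal_eq[OF nn g[of "pmf p k"]] by simp
    qed
  qed
  moreover have "\<dots> = (\<Sum>v. \<integral>\<^sup>+k. ennreal (w v * (1 - pmf p k) ^ v) \<partial>measure_pmf p)"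
    by (rule nn_integral_suminf) simp
  moreover have "g x \<ge> 0" if "0 < x" "x \<le> 1" for x
    using sums_le[OF _ sums_zero g[OF that]] nn that by simp
  ultimately show ?thesis
    by (simp add: infsum_pmf_mult_eq_nn_integral summable_sums)
qed

text \<open>On [0,1] the v-th term is dominated by \<open>\<bar>w v\<bar>\<close>, so absolute
  convergence permits the exchange. The same domination bounds \<open>g\<close>, hence both sides
  are finite.\<close>

lemma abs_summable_weights_sums:
  assumes w: "summable (\<lambda>v. \<bar>w v\<bar>)"
    and g: "\<And>x. 0 < x \<Longrightarrow> x \<le> 1 \<Longrightarrow> (\<lambda>v. w v * (1 - x) ^ v) sums g x"
    and nonneg: "\<And>x. 0 < x \<Longrightarrow> x \<le> 1 \<Longrightarrow> g x \<ge> 0"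
  shows "(\<lambda>v. ereal (w v) * zeta 1 v p) sums (\<Sum>\<^sub>\<infinity>k. ereal (pmf p k * g (pmf p k)))"
proof -
  have le: "\<bar>w v * (1 - x) ^ v\<bar> \<le> \<bar>w v\<bar>" if "0 \<le> x" "x \<le> 1" for v x
    using that by (simp add: abs_mult power_abs mult_left_le power_le_one)
  have g_le: "g x \<le> (\<Sum>v. \<bar>w v\<bar>)" if "0 < x" "x \<le> 1" for x
    using that le[of x] by (intro sums_le[OF _ g summable_sums[OF w]]) (auto intro: order_trans[OF abs_ge_self])
  have int: "integrable (measure_pmf p) (\<lambda>k. w v * (1 - pmf p k) ^ v)" for v
    by (rule measure_pmf.integrable_const_bound[of _ "\<bar>w v\<bar>"]) (auto simp: le pmf_le_1)
  have summ: "summable (\<lambda>v. \<bar>w v * (1 - pmf p k) ^ v\<bar>)" for k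
    by (rule summable_comparison_test[OF _ w]) (auto simp: le pmf_le_1)
  have summ_int: "summable (\<lambda>v. \<integral>k. norm (w v * (1 - pmf p k) ^ v) \<partial>measure_pmf p)"
  proof (rule summable_comparison_test[OF _ w], intro exI allI impI)
    fix v
    have "(\<integral>k. norm (w v * (1 - pmf p k) ^ v) \<partial>measure_pmf p) \<le> (\<integral>k. \<bar>w v\<bar> \<partial>measure_pmf p)"
      by (rule integral_mono) (use int le in \<open>auto simp: pmf_le_1\<close>)
    then show "norm (\<integral>k. norm (w v * (1 - pmf p k) ^ v) \<partial>measure_pmf p) \<le> \<bar>w v\<bar>"
      by simp
  qed
  have "measure_pmf.expectation p (\<lambda>k. g (pmf p k)) =
      measure_pmf.expectation p (\<lambda>k. \<Sum>v. w v * (1 - pmf p k) ^ v)"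
  proof (rule integral_cong_AE)
    show "AE k in measure_pmf p. g (pmf p k) = (\<Sum>v. w v * (1 - pmf p k) ^ v)"
      using AE_pmf_pos by eventually_elim (simp add: sums_unique[OF g])
  qed auto
  also have "\<dots> = (\<Sum>v. measure_pmf.expectation p (\<lambda>k. w v * (1 - pmf p k) ^ v))"
    by (rule integral_suminf) (use int summ summ_int in auto)
  finally have "(\<lambda>v. measure_pmf.expectation p (\<lambda>k. w v * (1 - pmf p k) ^ v)) sums
      measure_pmf.expectation p (\<lambda>k. g (pmf p k))"
    using summable_integral[OF int _ summ_int] summ by (simp add: summable_sums)
  then show ?thesis
    using infsum_pmf_mult_eq_expectation[of g, OF nonneg g_le] by (simp add: zeta_eq_expectation sums_ereal)
qed

end

section \<open>Criteria for linearity\<close>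

lemma linear_diversity_indexI:
  assumes "\<And>p. (\<lambda>v. ereal (w v) * zeta 1 v p) sums \<theta> p"
  shows "linear_diversity_index \<theta>"
  using assms unfolding linear_diversity_index_def by blast

text \<open>Weight 0 at index 0 completes a series that starts with \<open>zeta 1 1\<close>.\<close>

lemma linear_diversity_index_shiftI:
  fixes \<theta> :: "'a::countable diversity_index"
  assumes "\<And>p. (\<lambda>v. ereal (w v) * zeta 1 (Suc v) p) sums \<theta> p"
  shows "linear_diversity_index \<theta>"
proof (rule linear_diversity_indexI)
  fix p :: "'a pmf"
  define a where "a v = ereal (case v of 0 \<Rightarrow> 0 | Suc n \<Rightarrow> w n) * zeta 1 v p" for v
  have "(\<Sum>v<Suc n. a v) = (\<Sum>v<n. ereal (w v) * zeta 1 (Suc v) p)" for n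
    unfolding sum.lessThan_Suc_shift by (simp add: a_def zero_ereal_def[symmetric])
  then have "a sums \<theta> p"
    using assms[of p] LIMSEQ_imp_Suc[of "\<lambda>n. \<Sum>v<n. a v"] by (simp add: sums_def)
  then show "(\<lambda>v. ereal (case v of 0 \<Rightarrow> 0 | Suc n \<Rightarrow> w n) * zeta 1 v p) sums \<theta> p"
    by (simp add: a_def[abs_def])
qed

section \<open>The binomial series: Renyi's and Tsallis' entropies\<close>

lemma prod_eq_gbinomial:
  "(\<Prod>i=1..v. (real i - r) / real i) = (-1) ^ v * ((r - 1) gchoose v)"
proof (induction v)
  case (Suc v)
  \<comment> \<open>The quotient of consecutive coefficients is the negative of the new factor
    (v+1-r)/(v+1); the extra sign goes into the power of -1.\<close>
  have gb: "(r - 1 gchoose Suc v) = (r - 1 gchoose v) * (r - 1 - real v) / real (Suc v)"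
    by (simp add: gbinomial_prod_rev field_simps)
  have "(\<Prod>i=1..Suc v. (real i - r) / real i) =
      (\<Prod>i=1..v. (real i - r) / real i) * ((real (Suc v) - r) / real (Suc v))"
    by simp
  then show ?case
    unfolding Suc.IH gb by (simp add: field_simps)
qed simp

text \<open>The coefficients are O(v^(-a-1)) by their Gamma asymptotics, and a+1 > 1. Only
  boundedness of the quotient is used, so the limit may be 0, as it is for natural
  \<open>a\<close>.\<close>

lemma summable_abs_gbinomial:
  fixes a :: real
  assumes "a > 0"
  shows "summable (\<lambda>v. \<bar>a gchoose v\<bar>)"
proof -
  have "(\<lambda>n. (a gchoose n) / ((-1) ^ n / exp ((a + 1) * ln (real n)))) \<longlonglongrightarrow> inverse (Gamma (- a))"
    using gbinomial_asymptotic[of a] by simp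
  then have "Bseq (\<lambda>n. (a gchoose n) / ((-1) ^ n / exp ((a + 1) * ln (real n))))"
    by (intro convergent_imp_Bseq convergentI)
  then obtain K where K: "\<forall>n. norm ((a gchoose n) / ((-1) ^ n / exp ((a + 1) * ln (real n)))) \<le> K"
    by (rule BseqE)
  have "summable (\<lambda>n. K * real n powr (- (a + 1)))"
    using assms by (intro summable_mult) (simp add: summable_real_powr_iff)
  \<comment> \<open>The comparison starts at 1: at index 0 the bound is 0, since
    \<open>0 powr _ = 0\<close>, while the coefficient is 1.\<close>
  then show ?thesis
  proof (rule summable_comparison_test[rotated], intro exI[of _ 1] allI impI)
    fix n :: nat assume "n \<ge> 1"
    define E where "E = exp ((a + 1) * ln (real n))"
    have "\<bar>a gchoose n\<bar> * E \<le> K"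
      using K[rule_format, of n] by (simp add: E_def abs_mult power_abs)
    then have "\<bar>a gchoose n\<bar> \<le> K * inverse E"
      by (simp add: E_def field_simps)
    moreover have "real n powr (- (a + 1)) = inverse E"
      unfolding powr_minus E_def using \<open>n \<ge> 1\<close> by (simp add: powr_def)
    ultimately show "norm \<bar>a gchoose n\<bar> \<le> K * real n powr (- (a + 1))"
      by simp
  qed
qed

text \<open>For r < 1 all factors (i-r)/i are positive, so monotone convergence applies and the
  value may be infinite. For r > 1 the weights are absolutely summable. The empty product at v = 0
  yields the term \<open>zeta 1 0\<close>.\<close>

lemma renyi_sums:
  assumes "r > 0" "r \<noteq> 1"
  shows "(\<lambda>v. ereal (\<Prod>i=1..v. (real i - r) / real i) * zeta 1 v p) sums renyi_equivalent_entropy r p"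
proof -
  define w where "w v = (\<Prod>i=1..v. (real i - r) / real i)" for v
  have w: "w v = (-1) ^ v * ((r - 1) gchoose v)" for v
    unfolding w_def by (rule prod_eq_gbinomial)
  have g: "(\<lambda>v. w v * (1 - x) ^ v) sums (x powr (r - 1))" if "0 < x" "x \<le> 1" for x
  proof -
    \<comment> \<open>The sign of the weight turns the series into the binomial series of (1 +
      (x-1))^(r-1).\<close>
    have "w v * (1 - x) ^ v = (r - 1 gchoose v) * (x - 1) ^ v" for v
      using power_minus[of "1 - x" v] by (simp add: w)
    then show ?thesis
      using gen_binomial_real[of "x - 1" "r - 1"] that by simp
  qed
  have "(\<lambda>v. ereal (w v) * zeta 1 v p) sums (\<Sum>\<^sub>\<infinity>k. ereal (pmf p k * pmf p k powr (r - 1)))"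
  proof (cases "r < 1")
    case True
    show ?thesis
      by (rule nonneg_weights_sums[OF _ g]) (use True in \<open>auto simp: w_def intro!: prod_nonneg\<close>)
  next
    case False
    with assms have "summable (\<lambda>v. \<bar>w v\<bar>)"
      using summable_abs_gbinomial[of "r - 1"] by (simp add: w abs_mult power_abs)
    then show ?thesis
      by (rule abs_summable_weights_sums[OF _ g]) auto
  qed
  moreover have "pmf p k * pmf p k powr (r - 1) = pmf p k powr r" for k
    by (cases "pmf p k = 0") (simp_all add: powr_mult_base)
  ultimately show ?thesis
    by (simp add: w_def renyi_equivalent_entropy_def)
qed

lemma renyi_tail_sums:
  assumes "r > 0" "r \<noteq> 1"
  shows "(\<lambda>v. ereal (\<Prod>i=1..Suc v. (real i - r) / real i) * zeta 1 (Suc v) p) sums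
    (renyi_equivalent_entropy r p - 1)"
  using ereal_sums_Suc[OF renyi_sums[OF assms], of p] by (simp add: zeta_1_0 flip: one_ereal_def)

text \<open>The -1 in Tsallis' entropy cancels the term \<open>zeta 1 0\<close> of the Renyi series;
  what remains is the tail scaled by 1/(1-r).\<close>

lemma tsallis_sums:
  assumes "r > 0" "r \<noteq> 1"
  shows "(\<lambda>v. ereal (inverse (1 - r) * (\<Prod>i=1..Suc v. (real i - r) / real i)) * zeta 1 (Suc v) p) sums
    tsallis_entropy r p"
proof -
  let ?t = "\<lambda>v. ereal (\<Prod>i=1..Suc v. (real i - r) / real i) * zeta 1 (Suc v) p"
  \<comment> \<open>Multiplication by a finite constant preserves limits, infinite ones included.
    Distributing it over the partial sums is real arithmetic because each \<open>zeta 1 v p\<close>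
    is finite.\<close>
  have "(\<lambda>n. ereal (inverse (1 - r)) * (\<Sum>v<n. ?t v)) \<longlonglongrightarrow> tsallis_entropy r p"
    using renyi_tail_sums[OF assms, of p]
    by (auto simp: sums_def tsallis_entropy_def renyi_equivalent_entropy_def intro!: tendsto_cmult_ereal)
  moreover have "ereal (inverse (1 - r)) * (\<Sum>v<n. ?t v) =
      (\<Sum>v<n. ereal (inverse (1 - r) * (\<Prod>i=1..Suc v. (real i - r) / real i)) * zeta 1 (Suc v) p)" for n
    by (simp add: zeta_eq_expectation sum_distrib_left mult.assoc)
  ultimately show ?thesis by (simp add: sums_def)
qed

section \<open>Logarithmic, exponential and geometric series: Shannon, Emlen and richness\<close>

lemma shannon_sums:
  "(\<lambda>v. ereal (1 / real (Suc v)) * zeta 1 (Suc v) p) sums shannon_entropy p"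
proof -
  \<comment> \<open>The series of ln(1 + (x-1)). Its term at v = 0 vanishes because 1/0 = 0, so
    dropping it at the end leaves the value unchanged.\<close>
  have g: "(\<lambda>v. 1 / real v * (1 - x) ^ v) sums - ln x" if "0 < x" "x \<le> 1" for x
    using sums_minus[OF ln_series'[of "x - 1"]] that by (simp add: mult.commute)
  have nn: "- (pmf p k * ln (pmf p k)) \<ge> 0" for k
    using ln_le_zero_iff[of "pmf p k"] pmf_le_1[of p k] pmf_nonneg[of p k]
    by (cases "pmf p k = 0") (auto simp: mult_le_0_iff)
  have "(\<lambda>v. ereal (1 / real v) * zeta 1 v p) sums (\<Sum>\<^sub>\<infinity>k. ereal (pmf p k * - ln (pmf p k)))"
    by (rule nonneg_weights_sums[OF _ g]) auto
  moreover have "shannon_entropy p = (\<Sum>\<^sub>\<infinity>k. ereal (pmf p k * - ln (pmf p k)))"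
    using infsum_ereal_uminus_nonneg[of "\<lambda>k. - (pmf p k * ln (pmf p k))"] nn
    by (simp add: shannon_entropy_def)
  ultimately show ?thesis
    using ereal_sums_Suc[of "\<lambda>v. ereal (1 / real v) * zeta 1 v p" "shannon_entropy p"]
    by (simp add: zero_ereal_def[symmetric])
qed

lemma emlen_sums: "(\<lambda>v. ereal (exp (- 1) / fact v) * zeta 1 v p) sums emlen_index p"
proof -
  \<comment> \<open>Factor exp(-x) as exp(-1) * exp(1-x) and expand the second factor.\<close>
  have "(\<lambda>v. exp (- 1) / fact v * (1 - x) ^ v) sums exp (- x)" for x :: real
    using sums_mult[OF exp_converges[of "1 - x"], of "exp (- 1)"]
    by (simp add: scaleR_conv_of_real field_simps flip: exp_add)
  then show ?thesis
    unfolding emlen_index_def by (intro nonneg_weights_sums[where g = "\<lambda>x. exp (- x)"]) auto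
qed

text \<open>The geometric series with ratio 1-x sums to 1/x, and x * (1/x) is the indicator of x > 0
  on [0,1], with 1/0 = 0.\<close>

lemma richness_sums: "(\<lambda>v. zeta 1 v p) sums richness p"
proof -
  have g: "(\<lambda>v. 1 * (1 - x) ^ v) sums (1 / x)" if "0 < x" "x \<le> 1" for x :: real
    using geometric_sums[of "1 - x"] that by simp
  have "(\<lambda>v. ereal 1 * zeta 1 v p) sums (\<Sum>\<^sub>\<infinity>k. ereal (pmf p k * (1 / pmf p k)))"
    by (rule nonneg_weights_sums[OF _ g]) auto
  moreover have "pmf p k * (1 / pmf p k) = of_bool (pmf p k > 0)" for k
    using pmf_nonneg[of p k] by (cases "pmf p k = 0") auto
  ultimately show ?thesis
    by (simp add: richness_def one_ereal_def[symmetric])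
qed

section \<open>Binomial expansion: the generalized Simpson index\<close>

definition simpson_weight :: "nat \<Rightarrow> nat \<Rightarrow> nat \<Rightarrow> real" where
  "simpson_weight u m v =
     (if v \<in> {m..m + (u - 1)} then (- 1) ^ (v - m) * real ((u - 1) choose (v - m)) else 0)"

text \<open>The weights are the coefficients of x^(u-1) * (1-x)^m in powers of 1-x, found by
  expanding x^(u-1) = (1 - (1-x))^(u-1). Finitely many are nonzero, so they are absolutely
  summable.\<close>

lemma generalized_simpson_sums:
  assumes "u \<ge> 1"
  shows "(\<lambda>v. ereal (simpson_weight u m v) * zeta 1 v p) sums zeta u m p"
proof -
  define w where "w = simpson_weight u m"
  note w_eq = w_def simpson_weight_def
  have fin: "finite {v. w v \<noteq> 0}"
    by (rule finite_subset[of _ "{m..m + (u - 1)}"]) (auto simp: w_eq)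
  have g: "(\<lambda>v. w v * (1 - x) ^ v) sums (x ^ (u - 1) * (1 - x) ^ m)" for x
  proof -
    have "(\<lambda>v. w v * (1 - x) ^ v) sums (\<Sum>v\<in>{m..m + (u - 1)}. w v * (1 - x) ^ v)"
      by (rule sums_finite) (auto simp: w_eq)
    also have "(\<Sum>v\<in>{m..m + (u - 1)}. w v * (1 - x) ^ v) = (\<Sum>v\<le>u - 1. w (v + m) * (1 - x) ^ (v + m))"
      using sum.shift_bounds_cl_nat_ivl[of "\<lambda>v. w v * (1 - x) ^ v" 0 m "u - 1"]
      by (simp add: add.commute atMost_atLeast0)
    also have "\<dots> = (\<Sum>v\<le>u - 1. real (u - 1 choose v) * (- (1 - x)) ^ v) * (1 - x) ^ m"
      unfolding sum_distrib_right
    proof (intro sum.cong)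
      fix v assume "v \<in> {..u - 1}"
      then show "w (v + m) * (1 - x) ^ (v + m) = real (u - 1 choose v) * (- (1 - x)) ^ v * (1 - x) ^ m"
        by (subst power_minus) (simp add: w_eq power_add)
    qed simp
    also have "\<dots> = x ^ (u - 1) * (1 - x) ^ m"
      using binomial_ring[of "- (1 - x)" 1 "u - 1"] by simp
    finally show ?thesis .
  qed
  have "(\<lambda>v. ereal (w v) * zeta 1 v p) sums (\<Sum>\<^sub>\<infinity>k. ereal (pmf p k * (pmf p k ^ (u - 1) * (1 - pmf p k) ^ m)))"
  proof (rule abs_summable_weights_sums[OF _ g])
    show "summable (\<lambda>v. \<bar>w v\<bar>)"
      by (rule summable_finite[OF fin]) auto
  qed auto
  moreover have "pmf p k * (pmf p k ^ (u - 1) * (1 - pmf p k) ^ m) = pmf p k ^ u * (1 - pmf p k) ^ m" for k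
    using assms(1) by (cases u) auto
  ultimately show ?thesis
    unfolding w_def by (simp only: zeta_def[of u])
qed

text \<open>The series above has finite support, so by uniqueness of limits its value is a finite
  sum, reindexed from \<open>m\<close>.\<close>

lemma generalized_simpson_eq_sum:
  assumes "u \<ge> 1"
  shows "zeta u m p = (\<Sum>v=0..u - 1. ereal ((- 1) ^ v * real ((u - 1) choose v)) * zeta 1 (m + v) p)"
proof -
  define w where "w = simpson_weight u m"
  note w_eq = w_def simpson_weight_def
  have "(\<lambda>v. ereal (w v) * zeta 1 v p) sums (\<Sum>v\<in>{m..m + (u - 1)}. ereal (w v) * zeta 1 v p)"
    by (rule sums_finite) (auto simp: w_eq zero_ereal_def[symmetric])
  then have "zeta u m p = (\<Sum>v\<in>{m..m + (u - 1)}. ereal (w v) * zeta 1 v p)"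
    using generalized_simpson_sums[OF assms, of m p] unfolding w_def by (rule sums_unique2[rotated])
  also have "\<dots> = (\<Sum>v=0..u - 1. ereal (w (v + m)) * zeta 1 (v + m) p)"
    using sum.shift_bounds_cl_nat_ivl[of "\<lambda>v. ereal (w v) * zeta 1 v p" 0 m "u - 1"]
    by (simp add: add.commute)
  also have "\<dots> = (\<Sum>v=0..u - 1. ereal ((- 1) ^ v * real ((u - 1) choose v)) * zeta 1 (m + v) p)"
    by (intro sum.cong) (auto simp: w_eq add.commute)
  finally show ?thesis .
qed

section \<open>Simpson's and the Gini-Simpson index as generalized Simpson indices\<close>

lemma simpson_eq_zeta: "simpson = zeta 2 0"
  by (simp add: fun_eq_iff simpson_def zeta_def)

lemma simpson_eq: "simpson p = zeta 1 0 p - zeta 1 1 p"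
  unfolding simpson_eq_zeta
  by (subst generalized_simpson_eq_sum) (simp_all add: zeta_eq_expectation)

lemma gini_simpson_eq_zeta: "gini_simpson = zeta 1 1"
proof
  fix p :: "'a pmf"
  show "gini_simpson p = zeta 1 1 p"
    unfolding gini_simpson_def simpson_eq by (simp add: zeta_eq_expectation one_ereal_def)
qed

lemma linear_diversity_index_zeta:
  "u \<ge> 1 \<Longrightarrow> linear_diversity_index (zeta u m)"
  by (rule linear_diversity_indexI[of "simpson_weight u m"]) (rule generalized_simpson_sums)

theorem mainTheorem4:
  "(linear_diversity_index (simpson :: 'a::countable diversity_index) \<and>
     (\<forall>p :: 'a pmf. simpson p = zeta 1 0 p - zeta 1 1 p)) \<and>
   (linear_diversity_index (gini_simpson :: 'a diversity_index) \<and>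
     (\<forall>p :: 'a pmf.
        gini_simpson p = (\<Sum>\<^sub>\<infinity>k. ereal (pmf p k * (1 - pmf p k))) \<and>
        gini_simpson p = zeta 1 1 p)) \<and>
   (linear_diversity_index (shannon_entropy :: 'a diversity_index) \<and>
     (\<forall>p :: 'a pmf.
        (\<lambda>v. ereal (1 / real (Suc v)) * zeta 1 (Suc v) p) sums shannon_entropy p)) \<and>
   (\<forall>r::real. r > 0 \<and> r \<noteq> 1 \<longrightarrow>
     linear_diversity_index (renyi_equivalent_entropy r :: 'a diversity_index) \<and>
     (\<forall>p :: 'a pmf.
        summable (\<lambda>v. ereal (\<Prod>i=1..Suc v. (real i - r) / real i) * zeta 1 (Suc v) p) \<and>
        renyi_equivalent_entropy r p = zeta 1 0 p +
          (\<Sum>v. ereal (\<Prod>i=1..Suc v. (real i - r) / real i) * zeta 1 (Suc v) p))) \<and>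
   (linear_diversity_index (emlen_index :: 'a diversity_index) \<and>
     (\<forall>p :: 'a pmf.
        (\<lambda>v. ereal (exp (- 1) / fact v) * zeta 1 v p) sums emlen_index p)) \<and>
   (linear_diversity_index (richness :: 'a diversity_index) \<and>
     (\<forall>p :: 'a pmf. (\<lambda>v. zeta 1 v p) sums richness p)) \<and>
   (\<forall>u m :: nat. u \<ge> 1 \<longrightarrow>
     linear_diversity_index (zeta u m :: 'a diversity_index) \<and>
     (\<forall>p :: 'a pmf.
        zeta u m p =
          (\<Sum>v=0..u - 1. ereal ((- 1) ^ v * real ((u - 1) choose v)) * zeta 1 (m + v) p))) \<and>
   (\<forall>r::real. r > 0 \<and> r \<noteq> 1 \<longrightarrow>
     linear_diversity_index (tsallis_entropy r :: 'a diversity_index))"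
proof (intro conjI allI impI; (elim conjE)?)
  fix p :: "'a pmf"
  show "simpson p = zeta 1 0 p - zeta 1 1 p"
    by (rule simpson_eq)
  show "gini_simpson p = zeta 1 1 p"
    by (simp only: gini_simpson_eq_zeta)
  then show "gini_simpson p = (\<Sum>\<^sub>\<infinity>k. ereal (pmf p k * (1 - pmf p k)))"
    by (simp add: zeta_def)
  show "(\<lambda>v. ereal (1 / real (Suc v)) * zeta 1 (Suc v) p) sums shannon_entropy p"
    by (rule shannon_sums)
  show "(\<lambda>v. ereal (exp (- 1) / fact v) * zeta 1 v p) sums emlen_index p"
    by (rule emlen_sums)
  show "(\<lambda>v. zeta 1 v p) sums richness p"
    by (rule richness_sums)
next
  show "linear_diversity_index (simpson :: 'a diversity_index)"
    unfolding simpson_eq_zeta by (rule linear_diversity_index_zeta) simp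
  show "linear_diversity_index (gini_simpson :: 'a diversity_index)"
    unfolding gini_simpson_eq_zeta by (rule linear_diversity_index_zeta) simp
  show "linear_diversity_index (shannon_entropy :: 'a diversity_index)"
    by (rule linear_diversity_index_shiftI) (rule shannon_sums)
  show "linear_diversity_index (emlen_index :: 'a diversity_index)"
    by (rule linear_diversity_indexI) (rule emlen_sums)
  show "linear_diversity_index (richness :: 'a diversity_index)"
    by (rule linear_diversity_indexI[of "\<lambda>_. 1"]) (simp only: richness_sums one_ereal_def[symmetric] mult_1)
next
  fix u m :: nat and p :: "'a pmf"
  assume u: "u \<ge> 1"
  show "linear_diversity_index (zeta u m :: 'a diversity_index)"
    using u by (rule linear_diversity_index_zeta)
  show "zeta u m p = (\<Sum>v=0..u - 1. ereal ((- 1) ^ v * real ((u - 1) choose v)) * zeta 1 (m + v) p)"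
    using u by (rule generalized_simpson_eq_sum)
next
  fix r :: real and p :: "'a pmf"
  assume r: "r > 0" "r \<noteq> 1"
  show "linear_diversity_index (renyi_equivalent_entropy r :: 'a diversity_index)"
    by (rule linear_diversity_indexI) (rule renyi_sums[OF r])
  show "linear_diversity_index (tsallis_entropy r :: 'a diversity_index)"
    by (rule linear_diversity_index_shiftI) (rule tsallis_sums[OF r])
  note tail = renyi_tail_sums[OF r, of p]
  show "summable (\<lambda>v. ereal (\<Prod>i=1..Suc v. (real i - r) / real i) * zeta 1 (Suc v) p)"
    using tail by (rule sums_summable)
  \<comment> \<open>Cancelling the finite number 1 is valid for infinite values too.\<close>
  have "renyi_equivalent_entropy r p = 1 + (renyi_equivalent_entropy r p - 1)"
    by (cases "renyi_equivalent_entropy r p") (auto simp: one_ereal_def)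
  moreover have "zeta 1 0 p = 1"
    by (simp add: zeta_1_0)
  ultimately show "renyi_equivalent_entropy r p = zeta 1 0 p +
      (\<Sum>v. ereal (\<Prod>i=1..Suc v. (real i - r) / real i) * zeta 1 (Suc v) p)"
    by (simp only: sums_unique[OF tail, symmetric])
qed

end
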